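(* Let $\tau\ge0$ be an integer and let $\mu>\lambda>0$. Let $k\ge\tau+1$ be an integer. Then for all sufficiently large dimensions $d$ (how large may depend on $k,\tau,\mu,\lambda$), and for any algorithm for minimizing functions on $\mathbb{R}^d$ which is a delayed linear-span algorithm with delay $\tau$, the following hold. (1) There exists a $\mu$-smooth, $\lambda$-strongly convex function $F:\mathbb{R}^d\to\mathbb{R}$, with minimizer $\mathbf{w}^*$, such that the $k$-th iterate $\mathbf{w}_k$ of the algorithm on $F$ satisfies $$F(\mathbf{w}_k)-F(\mathbf{w}^* )\ \ge\ \frac{\lambda}{4}\exp\left(-\frac{5k}{\left(\sqrt{\mu/\lambda}-1\right)(\tau+1)}\right)\|\mathbf{w}_0-\mathbf{w}^*\|^2 .$$ (2) There exists a $\mu$-smooth, convex quadratic function $F:\mathbb{R}^d\to\mathbb{R}$, with a minimizer $\mathbf{w}^*$, such that the $k$-th iterate $\mathbf{w}_k$ of the algorithm on $F$ satisfies $$F(\mathbf{w}_k)-F(\mathbf{w}^* )\ \ge\ \frac{\mu(\tau+1)^2\,\|\mathbf{w}_0-\mathbf{w}^*\|^2}{45\,k^2}.$$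
   Context: A delayed linear-span algorithm with delay $\tau$ is any iterative algorithm that, on every differentiable $F:\mathbb{R}^d\to\mathbb{R}$, produces iterates $\mathbf{w}_0,\mathbf{w}_1,\ldots\in\mathbb{R}^d$ satisfying $$\mathbf{w}_0=\dots=\mathbf{w}_\tau=\mathbf{0}\quad\text{and}\quad \forall k\ge\tau,\ \ \mathbf{w}_{k+1}\in\mathrm{span}\{\nabla F(\mathbf{w}_0),\nabla F(\mathbf{w}_1),\dots,\nabla F(\mathbf{w}_{k-\tau})\}.$$ A differentiable function is $\mu$-smooth if its gradient is $\mu$-Lipschitz, and $\lambda$-strongly convex if $F-\frac{\lambda}{2}\|\cdot\|^2$ is convex. Norms are Euclidean. *)

theory Defs
  imports "HOL-Analysis.Analysis"
begin

text \<open>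
  Since the dimension \<open>d\<close> is quantified inside the statement, it cannot be a type.  All the spaces
  of \<open>d\<close>-tuples are therefore realised inside one inner product space, the real sequences of finite
  support, as the subspaces \<open>Rd d\<close> of sequences vanishing from index \<open>d\<close> on.
  (The library's norm on finitely supported functions is the sum norm, so it is not usable here.)
\<close>

typedef fin_seq = "{x :: nat \<Rightarrow> real. finite {i. x i \<noteq> 0}}"
  morphisms coord Abs_fin_seq
  by (rule exI[of _ "\<lambda>_. 0"]) simp

setup_lifting type_definition_fin_seq

lemma finite_coord: "finite {i. coord x i \<noteq> 0}"
  using coord[of x] by simp

instantiation fin_seq :: real_inner
begin

lift_definition zero_fin_seq :: fin_seq is "\<lambda>_. 0"
  by simp

lift_definition plus_fin_seq :: "fin_seq \<Rightarrow> fin_seq \<Rightarrow> fin_seq" is "\<lambda>x y i. x i + y i"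
proof -
  fix x y :: "nat \<Rightarrow> real"
  assume "finite {i. x i \<noteq> 0}" "finite {i. y i \<noteq> 0}"
  then show "finite {i. x i + y i \<noteq> 0}"
    by - (rule finite_subset[of _ "{i. x i \<noteq> 0} \<union> {i. y i \<noteq> 0}"], auto)
qed

lift_definition minus_fin_seq :: "fin_seq \<Rightarrow> fin_seq \<Rightarrow> fin_seq" is "\<lambda>x y i. x i - y i"
proof -
  fix x y :: "nat \<Rightarrow> real"
  assume "finite {i. x i \<noteq> 0}" "finite {i. y i \<noteq> 0}"
  then show "finite {i. x i - y i \<noteq> 0}"
    by - (rule finite_subset[of _ "{i. x i \<noteq> 0} \<union> {i. y i \<noteq> 0}"], auto)
qed

lift_definition uminus_fin_seq :: "fin_seq \<Rightarrow> fin_seq" is "\<lambda>x i. - x i"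
  by simp

lift_definition scaleR_fin_seq :: "real \<Rightarrow> fin_seq \<Rightarrow> fin_seq" is "\<lambda>r x i. r * x i"
  by (erule finite_subset[rotated]) auto

definition inner_fin_seq :: "fin_seq \<Rightarrow> fin_seq \<Rightarrow> real"
  where "inner_fin_seq x y = (\<Sum>i | coord x i \<noteq> 0. coord x i * coord y i)"

definition norm_fin_seq :: "fin_seq \<Rightarrow> real"
  where "norm_fin_seq x = sqrt (inner x x)"

definition sgn_fin_seq :: "fin_seq \<Rightarrow> fin_seq"
  where "sgn_fin_seq x = inverse (norm x) *\<^sub>R x"

definition dist_fin_seq :: "fin_seq \<Rightarrow> fin_seq \<Rightarrow> real"
  where "dist_fin_seq x y = norm (x - y)"

definition uniformity_fin_seq :: "(fin_seq \<times> fin_seq) filter"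
  where "uniformity_fin_seq = (INF e\<in>{0<..}. principal {(x, y). dist x y < e})"

definition open_fin_seq :: "fin_seq set \<Rightarrow> bool"
  where "open_fin_seq U \<longleftrightarrow> (\<forall>x\<in>U. \<forall>\<^sub>F (x', y) in uniformity. x' = x \<longrightarrow> y \<in> U)"

instance
proof
  fix x y z :: fin_seq and a b :: real
  show "x + y + z = x + (y + z)" "x + y = y + x" "0 + x = x" "- x + x = 0" "x - y = x + - y"
    "a *\<^sub>R (x + y) = a *\<^sub>R x + a *\<^sub>R y" "(a + b) *\<^sub>R x = a *\<^sub>R x + b *\<^sub>R x"
    "a *\<^sub>R b *\<^sub>R x = (a * b) *\<^sub>R x" "1 *\<^sub>R x = x"
    by (transfer; simp add: algebra_simps)+
  have inner_superset: "inner u v = (\<Sum>i\<in>S. coord u i * coord v i)"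
    if "finite S" "{i. coord u i \<noteq> 0} \<subseteq> S" for u v :: fin_seq and S
    unfolding inner_fin_seq_def using that by (intro sum.mono_neutral_left) auto
  define S where "S = {i. coord x i \<noteq> 0} \<union> {i. coord y i \<noteq> 0} \<union> {i. coord z i \<noteq> 0}"
  have S: "finite S"
    unfolding S_def by (intro finite_UnI finite_coord)
  have supp: "{i. coord x i \<noteq> 0} \<subseteq> S" "{i. coord y i \<noteq> 0} \<subseteq> S"
    "{i. coord (x + y) i \<noteq> 0} \<subseteq> S" "{i. coord (a *\<^sub>R x) i \<noteq> 0} \<subseteq> S"
    unfolding S_def by (auto simp: plus_fin_seq.rep_eq scaleR_fin_seq.rep_eq)
  show "inner x y = inner y x"
    by (simp add: inner_superset[OF S supp(1)] inner_superset[OF S supp(2)] mult.commute)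
  show "inner (x + y) z = inner x z + inner y z"
    by (simp add: inner_superset[OF S supp(1)] inner_superset[OF S supp(2)]
        inner_superset[OF S supp(3)] plus_fin_seq.rep_eq sum.distrib algebra_simps)
  show "inner (a *\<^sub>R x) y = a * inner x y"
    by (simp add: inner_superset[OF S supp(1)] inner_superset[OF S supp(4)]
        scaleR_fin_seq.rep_eq sum_distrib_left mult.assoc)
  show "0 \<le> inner x x"
    by (simp add: inner_fin_seq_def sum_nonneg)
  have "inner x x = 0 \<longleftrightarrow> (\<forall>i. coord x i = 0)"
    unfolding inner_fin_seq_def by (subst sum_nonneg_eq_0_iff[OF finite_coord]) auto
  also have "\<dots> \<longleftrightarrow> x = 0"
    by (auto simp: coord_inject[symmetric] zero_fin_seq.rep_eq)
  finally show "inner x x = 0 \<longleftrightarrow> x = 0" .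
qed (simp_all add: norm_fin_seq_def sgn_fin_seq_def dist_fin_seq_def uniformity_fin_seq_def
    open_fin_seq_def)

end

definition Rd :: "nat \<Rightarrow> fin_seq set"
  where "Rd d = {x. \<forall>i\<ge>d. coord x i = 0}"

lemma Rd_inner:
  assumes "x \<in> Rd d"
  shows "inner x y = (\<Sum>i<d. coord x i * coord y i)"
proof -
  have "{i. coord x i \<noteq> 0} \<subseteq> {..<d}"
  proof
    fix i assume "i \<in> {i. coord x i \<noteq> 0}"
    then show "i \<in> {..<d}"
      using assms by (cases "i < d") (simp_all add: Rd_def)
  qed
  then show ?thesis
    unfolding inner_fin_seq_def by (intro sum.mono_neutral_left) auto
qed

lemma Rd_norm:
  assumes "x \<in> Rd d"
  shows "norm x = sqrt (\<Sum>i<d. (coord x i)\<^sup>2)"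
  using Rd_inner[OF assms, of x] by (simp add: norm_eq_sqrt_inner power2_eq_square)

lemma subspace_Rd: "subspace (Rd d)"
  by (auto simp: subspace_def Rd_def zero_fin_seq.rep_eq plus_fin_seq.rep_eq scaleR_fin_seq.rep_eq)

lemma Rd_coordinates: "bij_betw (\<lambda>x. restrict (coord x) {..<d}) (Rd d) ({..<d} \<rightarrow>\<^sub>E UNIV)"
proof (rule bij_betwI')
  fix x y assume xy: "x \<in> Rd d" "y \<in> Rd d"
  have "coord x i = coord y i" if "restrict (coord x) {..<d} = restrict (coord y) {..<d}" for i
  proof (cases "i < d")
    case True
    then show ?thesis
      using fun_cong[OF that, of i] by simp
  next
    case False
    then show ?thesis
      using xy by (simp add: Rd_def)
  qed
  then show "restrict (coord x) {..<d} = restrict (coord y) {..<d} \<longleftrightarrow> x = y"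
    by (metis coord_inject ext)
next
  fix f :: "nat \<Rightarrow> real" assume f: "f \<in> {..<d} \<rightarrow>\<^sub>E UNIV"
  let ?g = "\<lambda>i. if i < d then f i else 0"
  have "finite {i. ?g i \<noteq> 0}"
    by (rule finite_subset[of _ "{..<d}"]) auto
  then have *: "coord (Abs_fin_seq ?g) = ?g"
    by (simp add: Abs_fin_seq_inverse)
  show "\<exists>x\<in>Rd d. f = restrict (coord x) {..<d}"
    by (rule bexI[of _ "Abs_fin_seq ?g"])
      (use f in \<open>auto simp: * Rd_def fun_eq_iff restrict_def PiE_def extensional_def\<close>)
qed auto

text \<open>
  A function on \<open>Rd d\<close> is a function on the whole type of which only the values on \<open>Rd d\<close> matter;
  derivatives are taken within \<open>Rd d\<close>.  The condition that the gradient lies in \<open>E\<close> makes it unique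
  when \<open>E\<close> is a subspace.
\<close>

definition gradient_on :: "'a::real_inner set \<Rightarrow> ('a \<Rightarrow> real) \<Rightarrow> 'a \<Rightarrow> 'a"
  where "gradient_on E F x = (THE g. g \<in> E \<and> (F has_derivative (\<lambda>h. inner g h)) (at x within E))"

lemma gradient_on_eq:
  assumes E: "subspace E" and x: "x \<in> E" and g: "g \<in> E"
    and D: "(F has_derivative (\<lambda>h. inner g h)) (at x within E)"
  shows "gradient_on E F x = g"
  unfolding gradient_on_def
proof (rule the_equality)
  fix g' assume g': "g' \<in> E \<and> (F has_derivative (\<lambda>h. inner g' h)) (at x within E)"
  define h where "h = g' - g"
  have h: "h \<in> E"
    using g g' E by (simp add: h_def subspace_diff)
  have line: "((\<lambda>t. x + t *\<^sub>R h) has_derivative (\<lambda>t. t *\<^sub>R h)) (at (0::real))"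
    by (auto intro!: derivative_eq_intros)
  have im: "(\<lambda>t. x + t *\<^sub>R h) ` UNIV \<subseteq> E"
    using E x h by (auto intro: subspace_add subspace_scale)
  have chain: "((\<lambda>t. F (x + t *\<^sub>R h)) has_derivative (\<lambda>t. inner u (t *\<^sub>R h))) (at 0)"
    if "(F has_derivative (\<lambda>h. inner u h)) (at x within E)" for u
    using has_derivative_in_compose[OF line, of F "\<lambda>h. inner u h"]
      has_derivative_subset[OF that im] by simp
  have "(\<lambda>t::real. inner g' (t *\<^sub>R h)) = (\<lambda>t. inner g (t *\<^sub>R h))"
    by (rule has_derivative_unique[OF chain chain]) (use g' D in simp_all)
  from fun_cong[OF this, of 1] have "inner h h = 0"
    by (simp add: h_def inner_diff_left)
  then show "g' = g"
    by (simp add: h_def)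
qed (use g D in simp)

definition smooth_on_space :: "real \<Rightarrow> 'a::real_inner set \<Rightarrow> ('a \<Rightarrow> real) \<Rightarrow> bool"
  where "smooth_on_space \<mu> E F \<longleftrightarrow> F differentiable_on E \<and> \<mu>-lipschitz_on E (gradient_on E F)"

definition strongly_convex_on :: "real \<Rightarrow> 'a::real_inner set \<Rightarrow> ('a \<Rightarrow> real) \<Rightarrow> bool"
  where "strongly_convex_on \<alpha> E F \<longleftrightarrow> convex_on E (\<lambda>w. F w - \<alpha> / 2 * (norm w)\<^sup>2)"

definition quadratic_on_Rd :: "nat \<Rightarrow> (fin_seq \<Rightarrow> real) \<Rightarrow> bool"
  where "quadratic_on_Rd d F \<longleftrightarrow>
    (\<exists>(Q :: nat \<Rightarrow> nat \<Rightarrow> real) b c. \<forall>w\<in>Rd d.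
      F w = (\<Sum>i<d. \<Sum>j<d. Q i j * coord w i * coord w j) + (\<Sum>i<d. b i * coord w i) + c)"

text \<open>\<open>A F k\<close> is the \<open>k\<close>-th iterate that the algorithm \<open>A\<close> produces on the objective \<open>F\<close>.\<close>

definition delayed_linear_span_algorithm ::
    "nat \<Rightarrow> 'a::real_inner set \<Rightarrow> (('a \<Rightarrow> real) \<Rightarrow> nat \<Rightarrow> 'a) \<Rightarrow> bool"
  where "delayed_linear_span_algorithm \<tau> E A \<longleftrightarrow>
    (\<forall>F. F differentiable_on E \<longrightarrow>
      (\<forall>k. A F k \<in> E) \<and>
      (\<forall>k\<le>\<tau>. A F k = 0) \<and>
      (\<forall>k\<ge>\<tau>. A F (Suc k) \<in> span ((\<lambda>j. gradient_on E F (A F j)) ` {0..k - \<tau>})))"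

end

theory Submission
  imports Defs
begin

text \<open>
  Both hard functions are Nesterov chains
  \<open>\<alpha> / 2 * ((w\<^sub>0 - 1)\<^sup>2 + \<Sum>i<N. (w\<^sub>i\<^sub>+\<^sub>1 - w\<^sub>i)\<^sup>2 + c\<^sup>2 * w\<^sub>N\<^sup>2) + \<beta> / 2 * \<parallel>w\<parallel>\<^sup>2\<close>.
  A gradient has at most one nonzero coordinate beyond those of the query point, and with delay \<open>\<tau>\<close>
  only every \<open>(\<tau> + 1)\<close>-th step can profit from it, so \<open>w\<^sub>k\<close> is supported on the first
  \<open>m = k div (\<tau> + 1)\<close> coordinates.  For (1) take \<open>\<beta>\<close> to be the convexity parameter and
  \<open>N + 1 = 2 * m\<close>: the minimizer is geometric with ratio \<open>q = (\<surd>\<kappa> - 1) / (\<surd>\<kappa> + 1)\<close>, \<open>\<kappa>\<close> the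
  condition number, and the coordinates from \<open>m\<close> on carry at least the fraction \<open>q ^ (2 * m) / 2\<close> of
  its squared norm.  For (2) take \<open>\<beta> = c = 0\<close> and \<open>N = m\<close>: the minimizer is the
  all-ones vector, with value \<open>0\<close>, whereas an iterate must drop from \<open>1\<close> to \<open>0\<close> in \<open>m + 1\<close> increments,
  which costs at least \<open>\<alpha> / (2 * (m + 1))\<close>.
\<close>

section \<open>Regularized least squares on a subspace\<close>

text \<open>Both hard functions have this shape, so the gradient, smoothness, convexity and the gap
  above the minimum are computed once for arbitrary functionals \<open>a i\<close>.\<close>

locale regularized_least_squares =
  fixes E :: "'a::real_inner set" and I :: "'i set" and a :: "'i \<Rightarrow> 'a" and y :: "'i \<Rightarrow> real"
    and \<alpha> \<beta> :: real
  assumes subspace_E: "subspace E" and a_in_E: "i \<in> I \<Longrightarrow> a i \<in> E"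
    and \<alpha>_nonneg: "0 \<le> \<alpha>" and \<beta>_nonneg: "0 \<le> \<beta>"
begin

definition objective :: "'a \<Rightarrow> real"
  where "objective w = \<alpha> / 2 * (\<Sum>i\<in>I. (inner (a i) w - y i)\<^sup>2) + \<beta> / 2 * (norm w)\<^sup>2"

definition grad :: "'a \<Rightarrow> 'a"
  where "grad w = \<alpha> *\<^sub>R (\<Sum>i\<in>I. (inner (a i) w - y i) *\<^sub>R a i) + \<beta> *\<^sub>R w"

lemma grad_in_E: "w \<in> E \<Longrightarrow> grad w \<in> E"
  unfolding grad_def
  by (intro subspace_add subspace_scale subspace_sum subspace_E a_in_E)

lemma objective_has_derivative: "(objective has_derivative inner (grad w)) (at w within S)"
proof -
  have "((\<lambda>w. p * (\<Sum>i\<in>I. (inner (a i) w - y i)\<^sup>2) + r * inner w w) has_derivative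
      (\<lambda>h. p * (\<Sum>i\<in>I. 2 * (inner (a i) w - y i) * inner (a i) h) +
        r * (inner w h + inner h w))) (at w within S)" for p r :: real
    by (rule derivative_eq_intros refl | simp add: fun_eq_iff algebra_simps)+
  from this[of "\<alpha> / 2" "\<beta> / 2"] show ?thesis
    unfolding objective_def[abs_def] power2_norm_eq_inner
  proof (rule has_derivative_eq_rhs, intro ext)
    fix h
    show "\<alpha> / 2 * (\<Sum>i\<in>I. 2 * (inner (a i) w - y i) * inner (a i) h) +
      \<beta> / 2 * (inner w h + inner h w) = inner (grad w) h"
    proof -
      have "(\<Sum>i\<in>I. 2 * (inner (a i) w - y i) * inner (a i) h) =
          2 * (\<Sum>i\<in>I. (inner (a i) w - y i) * inner (a i) h)"
        by (simp only: sum_distrib_left mult.assoc)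
      then show ?thesis
        by (simp add: grad_def inner_add_left inner_sum_left inner_commute[of h w])
    qed
  qed
qed

lemma objective_differentiable: "objective differentiable_on E"
  using objective_has_derivative by (auto simp: differentiable_on_def differentiable_def)

lemma gradient_on_objective: "w \<in> E \<Longrightarrow> gradient_on E objective w = grad w"
  by (rule gradient_on_eq[OF subspace_E _ grad_in_E objective_has_derivative])

text \<open>
  Cauchy-Schwarz for the semi-inner product \<open>(u, v) \<mapsto> \<Sum>i\<in>I. inner (a i) u * inner (a i) v\<close> turns
  the bound on the quadratic form into a bound on the operator norm.
\<close>

lemma norm_frame_operator_le:
  assumes L: "\<And>v. v \<in> E \<Longrightarrow> (\<Sum>i\<in>I. (inner (a i) v)\<^sup>2) \<le> L * (norm v)\<^sup>2" and "0 \<le> L"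
    and v: "v \<in> E"
  shows "norm (\<Sum>i\<in>I. inner (a i) v *\<^sub>R a i) \<le> L * norm v"
proof -
  define u where "u = (\<Sum>i\<in>I. inner (a i) v *\<^sub>R a i)"
  have u: "u \<in> E"
    unfolding u_def by (intro subspace_sum subspace_scale subspace_E a_in_E)
  have "(norm u)\<^sup>2 = (\<Sum>i\<in>I. inner (a i) v * inner (a i) u)"
    unfolding power2_norm_eq_inner by (subst u_def) (simp add: inner_sum_left)
  then have "((norm u)\<^sup>2)\<^sup>2 \<le> (\<Sum>i\<in>I. (inner (a i) v)\<^sup>2) * (\<Sum>i\<in>I. (inner (a i) u)\<^sup>2)"
    using Cauchy_Schwarz_ineq_sum[of "\<lambda>i. inner (a i) v" "\<lambda>i. inner (a i) u" I] by simp
  also have "\<dots> \<le> (L * (norm v)\<^sup>2) * (L * (norm u)\<^sup>2)"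
    by (intro mult_mono L u v sum_nonneg mult_nonneg_nonneg \<open>0 \<le> L\<close>) auto
  also have "\<dots> = (L * norm v * norm u)\<^sup>2"
    by (simp add: power2_eq_square)
  finally have "(norm u)\<^sup>2 \<le> L * norm v * norm u"
    by (rule power2_le_imp_le) (simp add: \<open>0 \<le> L\<close>)
  then show ?thesis
    unfolding u_def[symmetric] using \<open>0 \<le> L\<close> by (cases "norm u = 0") (simp_all add: power2_eq_square)
qed

text \<open>The targets \<open>y i\<close> cancel in a difference of gradients, leaving \<alpha>
  times the frame operator plus \<beta> times the identity, applied to \<open>u - v\<close>.\<close>

lemma objective_smooth:
  assumes L: "\<And>v. v \<in> E \<Longrightarrow> (\<Sum>i\<in>I. (inner (a i) v)\<^sup>2) \<le> L * (norm v)\<^sup>2" and "0 \<le> L"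
  shows "smooth_on_space (\<alpha> * L + \<beta>) E objective"
  unfolding smooth_on_space_def
proof (intro conjI objective_differentiable lipschitz_onI)
  fix u v assume uv: "u \<in> E" "v \<in> E"
  then have diff: "u - v \<in> E"
    by (intro subspace_diff subspace_E)
  have "grad u - grad v = \<alpha> *\<^sub>R (\<Sum>i\<in>I. inner (a i) (u - v) *\<^sub>R a i) + \<beta> *\<^sub>R (u - v)"
    by (simp add: grad_def algebra_simps sum_subtractf)
  then have "norm (grad u - grad v) \<le>
      \<alpha> * norm (\<Sum>i\<in>I. inner (a i) (u - v) *\<^sub>R a i) + \<beta> * norm (u - v)"
    using \<alpha>_nonneg \<beta>_nonneg by (auto intro: norm_triangle_le)
  also have "\<dots> \<le> \<alpha> * (L * norm (u - v)) + \<beta> * norm (u - v)"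
    by (intro add_right_mono mult_left_mono norm_frame_operator_le L \<open>0 \<le> L\<close> diff \<alpha>_nonneg)
  finally show "dist (gradient_on E objective u) (gradient_on E objective v) \<le>
      (\<alpha> * L + \<beta>) * dist u v"
    by (simp add: gradient_on_objective uv dist_norm algebra_simps)
qed (simp add: \<alpha>_nonneg \<beta>_nonneg \<open>0 \<le> L\<close>)

text \<open>Subtracting the \<beta> term leaves a nonnegative multiple of a sum of squares of affine
  functions. For \<beta> = 0 this is plain convexity, the form that the quadratic case uses.\<close>

lemma objective_strongly_convex: "strongly_convex_on \<beta> E objective"
proof -
  have square: "((1 - t) * r + t * s)\<^sup>2 \<le> (1 - t) * r\<^sup>2 + t * s\<^sup>2"
    if "0 < t" "t < 1" for r s t :: real
  proof -
    have "(1 - t) * r\<^sup>2 + t * s\<^sup>2 - ((1 - t) * r + t * s)\<^sup>2 = t * (1 - t) * (r - s)\<^sup>2"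
      by (simp add: power2_eq_square algebra_simps)
    then show ?thesis
      using that by (smt (verit) mult_nonneg_nonneg zero_le_power2)
  qed
  have "convex_on E (\<lambda>w. \<Sum>i\<in>I. (inner (a i) w - y i)\<^sup>2)"
  proof (rule convex_onI)
    fix t :: real and u v assume t: "0 < t" "t < 1"
    have "inner (a i) ((1 - t) *\<^sub>R u + t *\<^sub>R v) - y i =
        (1 - t) * (inner (a i) u - y i) + t * (inner (a i) v - y i)" for i
      by (simp add: algebra_simps)
    then show "(\<Sum>i\<in>I. (inner (a i) ((1 - t) *\<^sub>R u + t *\<^sub>R v) - y i)\<^sup>2) \<le>
        (1 - t) * (\<Sum>i\<in>I. (inner (a i) u - y i)\<^sup>2) + t * (\<Sum>i\<in>I. (inner (a i) v - y i)\<^sup>2)"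
      by (auto simp: sum_distrib_left simp flip: sum.distrib intro!: sum_mono square[OF t])
  qed (rule subspace_imp_convex[OF subspace_E])
  then have "convex_on E (\<lambda>w. \<alpha> / 2 * (\<Sum>i\<in>I. (inner (a i) w - y i)\<^sup>2))"
    by (intro convex_on_cmul) (simp_all add: \<alpha>_nonneg)
  then show ?thesis
    by (simp add: strongly_convex_on_def objective_def)
qed

text \<open>The second-order Taylor expansion of a quadratic is exact, and its linear term vanishes
  at \<open>w\<close>. Minimality of \<open>w\<close> and both lower bounds on the gap come from
  it.\<close>

lemma objective_diff_critical:
  assumes "grad w = 0"
  shows "objective v - objective w =
    \<alpha> / 2 * (\<Sum>i\<in>I. (inner (a i) (v - w))\<^sup>2) + \<beta> / 2 * (norm (v - w))\<^sup>2"
proof -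
  have "inner (grad w) (v - w) = 0"
    using assms by simp
  then have *: "\<alpha> * (\<Sum>i\<in>I. (inner (a i) w - y i) * inner (a i) (v - w)) + \<beta> * inner w (v - w) = 0"
    by (simp only: grad_def inner_add_left inner_scaleR_left inner_sum_left)
  have "(\<Sum>i\<in>I. (inner (a i) v - y i)\<^sup>2) = (\<Sum>i\<in>I. (inner (a i) w - y i)\<^sup>2) +
      2 * (\<Sum>i\<in>I. (inner (a i) w - y i) * inner (a i) (v - w)) +
      (\<Sum>i\<in>I. (inner (a i) (v - w))\<^sup>2)"
    unfolding sum_distrib_left sum.distrib[symmetric]
    by (rule sum.cong) (simp_all add: power2_eq_square algebra_simps)
  moreover have "(norm v)\<^sup>2 = (norm w)\<^sup>2 + 2 * inner w (v - w) + (norm (v - w))\<^sup>2"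
    by (simp add: power2_norm_eq_inner algebra_simps inner_commute)
  \<comment> \<open>The cross terms combine to \<open>\<alpha> * G + \<beta> * H\<close>, which is
    \<open>inner (grad w) (v - w)\<close>.\<close>
  moreover have "\<alpha> / 2 * P + \<beta> / 2 * M - (\<alpha> / 2 * Q + \<beta> / 2 * N) = \<alpha> / 2 * R + \<beta> / 2 * K"
    if "P = Q + 2 * G + R" "M = N + 2 * H + K" "\<alpha> * G + \<beta> * H = 0" for P Q R M N K G H
  proof -
    have "\<alpha> / 2 * P + \<beta> / 2 * M - (\<alpha> / 2 * Q + \<beta> / 2 * N) =
        \<alpha> / 2 * R + \<beta> / 2 * K + (\<alpha> * G + \<beta> * H)"
      by (simp add: that(1,2) field_simps)
    then show ?thesis
      by (simp add: that(3))
  qed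
  ultimately show ?thesis
    using * unfolding objective_def by blast
qed

lemma critical_is_arg_min:
  assumes "grad w = 0" "w \<in> E"
  shows "is_arg_min objective (\<lambda>v. v \<in> E) w"
proof -
  have "objective w \<le> objective v" for v
    using objective_diff_critical[OF assms(1), of v] \<alpha>_nonneg \<beta>_nonneg
    by (smt (verit) divide_nonneg_nonneg mult_nonneg_nonneg sum_nonneg zero_le_power2)
  then show ?thesis
    using assms(2) by (auto simp: is_arg_min_def not_less)
qed

end

section \<open>Quadratic functions on coordinate spaces\<close>

lemma quadratic_on_Rd_add:
  assumes "quadratic_on_Rd d F" "quadratic_on_Rd d G"
  shows "quadratic_on_Rd d (\<lambda>w. F w + G w)"
proof -
  obtain Q b c Q' b' c' where
    "\<forall>w\<in>Rd d. F w = (\<Sum>i<d. \<Sum>j<d. Q i j * coord w i * coord w j) + (\<Sum>i<d. b i * coord w i) + c"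
    "\<forall>w\<in>Rd d. G w = (\<Sum>i<d. \<Sum>j<d. Q' i j * coord w i * coord w j) + (\<Sum>i<d. b' i * coord w i) + c'"
    using assms unfolding quadratic_on_Rd_def by blast
  then show ?thesis
    unfolding quadratic_on_Rd_def
    by (intro exI[of _ "\<lambda>i j. Q i j + Q' i j"] exI[of _ "\<lambda>i. b i + b' i"] exI[of _ "c + c'"])
      (simp add: distrib_right sum.distrib)
qed

lemma quadratic_on_Rd_sum:
  "(\<And>i. i \<in> I \<Longrightarrow> quadratic_on_Rd d (F i)) \<Longrightarrow> quadratic_on_Rd d (\<lambda>w. \<Sum>i\<in>I. F i w)"
proof (induction I rule: infinite_finite_induct)
  case (insert i I)
  then show ?case
    by (simp add: quadratic_on_Rd_add)
qed (auto simp: quadratic_on_Rd_def intro!: exI[of _ "\<lambda>_ _. 0"] exI[of _ "\<lambda>_. 0"] exI[of _ 0])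

text \<open>The factor \<open>r\<close> stays inside the term, so that closure under sums already
  covers the objective with \<beta> = 0.\<close>

lemma quadratic_on_Rd_cmult_square:
  assumes "a \<in> Rd d"
  shows "quadratic_on_Rd d (\<lambda>w. r * (inner a w - y)\<^sup>2)"
  unfolding quadratic_on_Rd_def
proof (intro exI ballI)
  fix w
  have "(inner a w)\<^sup>2 = (\<Sum>i<d. \<Sum>j<d. coord a i * coord a j * coord w i * coord w j)"
    by (simp add: Rd_inner[OF assms] power2_eq_square sum_product mult_ac)
  moreover have "inner a w = (\<Sum>i<d. coord a i * coord w i)"
    by (rule Rd_inner[OF assms])
  moreover have "(\<Sum>i<d. - 2 * r * y * coord a i * coord w i) =
      - 2 * r * y * (\<Sum>i<d. coord a i * coord w i)"
    by (simp add: sum_distrib_left mult.assoc)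
  moreover have "(\<Sum>i<d. \<Sum>j<d. r * coord a i * coord a j * coord w i * coord w j) =
      r * (\<Sum>i<d. \<Sum>j<d. coord a i * coord a j * coord w i * coord w j)"
    by (simp add: sum_distrib_left mult.assoc)
  ultimately show "r * (inner a w - y)\<^sup>2 =
      (\<Sum>i<d. \<Sum>j<d. r * coord a i * coord a j * coord w i * coord w j) +
      (\<Sum>i<d. - 2 * r * y * coord a i * coord w i) + r * y\<^sup>2"
    by (simp only: power2_diff) (simp add: algebra_simps)
qed

section \<open>Propagation of supports under delay\<close>

lemma Rd_mono: "m \<le> n \<Longrightarrow> Rd m \<subseteq> Rd n"
  by (auto simp: Rd_def)

text \<open>The iterate \<open>k = Suc l\<close> combines gradients at queries
  \<open>j \<le> l - \<tau> = k - (\<tau> + 1)\<close>. By induction and monotonicity these queries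
  lie at level \<open>(k - (\<tau> + 1)) div (\<tau> + 1)\<close> of \<open>V\<close>; a gradient
  raises the level by one, which gives exactly \<open>k div (\<tau> + 1)\<close>. Up to index \<tau>
  the iterates are 0, which lies in every subspace.\<close>

lemma delayed_linear_span_algorithm_iterate:
  assumes A: "delayed_linear_span_algorithm \<tau> E A" and F: "F differentiable_on E"
    and V: "\<And>m. subspace (V m)" "mono V"
    and step: "\<And>m x. x \<in> E \<Longrightarrow> x \<in> V m \<Longrightarrow> gradient_on E F x \<in> V (Suc m)"
  shows "A F k \<in> V (k div (\<tau> + 1))"
proof (induction k rule: less_induct)
  case (less k)
  show ?case
  proof (cases "k \<le> \<tau>")
    case True
    then show ?thesis
      using A F V(1) by (simp add: delayed_linear_span_algorithm_def subspace_0)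
  next
    case False
    then obtain l where k: "k = Suc l" "\<tau> \<le> l"
      by (cases k) auto
    have k_div: "k div (\<tau> + 1) = Suc ((l - \<tau>) div (\<tau> + 1))"
    proof -
      have "k = (\<tau> + 1) + (l - \<tau>)"
        using k by simp
      then show ?thesis
        by (metis One_nat_def Suc_eq_plus1 add.commute div_add_self1 nat.simps(3))
    qed
    have "gradient_on E F (A F j) \<in> V (k div (\<tau> + 1))" if "j \<le> l - \<tau>" for j
    proof -
      have "A F j \<in> V (j div (\<tau> + 1))"
        using that k by (intro less) auto
      then have "A F j \<in> V ((l - \<tau>) div (\<tau> + 1))"
        using monoD[OF V(2) div_le_mono[OF that]] by blast
      moreover have "A F j \<in> E"
        using A F by (simp add: delayed_linear_span_algorithm_def)
      ultimately show ?thesis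
        using step k_div by simp
    qed
    then have "span ((\<lambda>j. gradient_on E F (A F j)) ` {0..l - \<tau>}) \<subseteq> V (k div (\<tau> + 1))"
      by (intro span_minimal V(1)) auto
    then show ?thesis
      using A F k by (auto simp: delayed_linear_span_algorithm_def)
  qed
qed

section \<open>Standard basis vectors\<close>

lift_definition unit_seq :: "nat \<Rightarrow> fin_seq" is "\<lambda>n i. if i = n then 1 else 0"
  by simp

lemma inner_unit_seq [simp]: "inner (unit_seq i) x = coord x i"
proof -
  have "{j. coord (unit_seq i) j \<noteq> 0} = {i}"
    by (auto simp: unit_seq.rep_eq)
  then show ?thesis
    by (simp add: inner_fin_seq_def unit_seq.rep_eq)
qed

lemma unit_seq_in_Rd: "i < d \<Longrightarrow> unit_seq i \<in> Rd d"
  by (simp add: Rd_def unit_seq.rep_eq)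

lemma coord_diff: "coord (x - y) i = coord x i - coord y i"
  by (simp add: minus_fin_seq.rep_eq)

lemma coord_sum_unit_seq:
  "coord (\<Sum>i<n. f i *\<^sub>R unit_seq i) j = (if j < n then f j else 0)"
  by (induction n)
    (auto simp: less_Suc_eq zero_fin_seq.rep_eq plus_fin_seq.rep_eq scaleR_fin_seq.rep_eq unit_seq.rep_eq)

lemma sum_unit_seq_in_Rd: "n \<le> d \<Longrightarrow> (\<Sum>i<n. f i *\<^sub>R unit_seq i) \<in> Rd d"
  by (simp add: Rd_def coord_sum_unit_seq)

lemma norm_sum_unit_seq: "(norm (\<Sum>i<n. f i *\<^sub>R unit_seq i))\<^sup>2 = (\<Sum>i<n. (f i)\<^sup>2)"
  by (simp add: Rd_norm[OF sum_unit_seq_in_Rd[OF order_refl]] coord_sum_unit_seq sum_nonneg)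

lemma sum_coord_le_norm:
  assumes "finite S"
  shows "(\<Sum>i\<in>S. (coord x i)\<^sup>2) \<le> (norm x)\<^sup>2"
proof -
  have "(\<Sum>i\<in>S. (coord x i)\<^sup>2) \<le> (\<Sum>i\<in>S \<union> {i. coord x i \<noteq> 0}. (coord x i)\<^sup>2)"
    by (rule sum_mono2) (use assms finite_coord in auto)
  also have "\<dots> = (\<Sum>i | coord x i \<noteq> 0. (coord x i)\<^sup>2)"
    by (rule sum.mono_neutral_right) (use assms finite_coord in auto)
  also have "\<dots> = (norm x)\<^sup>2"
    unfolding power2_norm_eq_inner inner_fin_seq_def by (simp add: power2_eq_square)
  finally show ?thesis .
qed

section \<open>Chain functions\<close>

text \<open>Row 0 will get target 1 and every other row target 0, so the residuals are the start
  condition, the \<open>N\<close> increments and the end term weighted by \<open>c\<close>. Only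
  rows up to \<open>Suc N\<close> are ever summed; later ones are default values.\<close>

fun chain :: "nat \<Rightarrow> real \<Rightarrow> nat \<Rightarrow> fin_seq"
  where
    "chain N c 0 = unit_seq 0"
  | "chain N c (Suc i) = (if i < N then unit_seq (Suc i) - unit_seq i else c *\<^sub>R unit_seq i)"

lemma sum_chain:
  fixes f :: "nat \<Rightarrow> 'b::comm_monoid_add"
  shows "(\<Sum>i\<le>Suc N. f i) = f 0 + (\<Sum>i<N. f (Suc i)) + f (Suc N)"
  by (simp add: sum.atMost_Suc_shift sum.atMost_shift add_ac)

text \<open>The square of a difference is at most twice the sum of the two squares, and each
  coordinate occurs in at most two rows; hence the constant 4.\<close>

lemma chain_form_le:
  assumes "c\<^sup>2 \<le> 1"
  shows "(\<Sum>i\<le>Suc N. (inner (chain N c i) v)\<^sup>2) \<le> 4 * (norm v)\<^sup>2"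
proof -
  define x where "x = coord v"
  \<comment> \<open>The slack \<open>2 * (x N)\<^sup>2\<close> absorbs the share of
    \<open>x N\<close> in the next increment during the induction, and pays for the end row
    afterwards.\<close>
  have chain: "(x 0)\<^sup>2 + (\<Sum>i<N. (x (Suc i) - x i)\<^sup>2) \<le> 4 * (\<Sum>i\<le>N. (x i)\<^sup>2) - 2 * (x N)\<^sup>2"
  proof (induction N)
    case (Suc N)
    have "(x (Suc N) - x N)\<^sup>2 + (x (Suc N) + x N)\<^sup>2 = 2 * (x (Suc N))\<^sup>2 + 2 * (x N)\<^sup>2"
      by (simp add: power2_eq_square algebra_simps)
    then have "(x (Suc N) - x N)\<^sup>2 \<le> 2 * (x (Suc N))\<^sup>2 + 2 * (x N)\<^sup>2"
      using zero_le_power2[of "x (Suc N) + x N"] by linarith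
    then show ?case
      using Suc by simp
  qed simp
  have "c\<^sup>2 * (x N)\<^sup>2 \<le> 1 * (x N)\<^sup>2"
    using assms by (intro mult_right_mono) auto
  moreover have "(\<Sum>i\<le>Suc N. (inner (chain N c i) v)\<^sup>2) =
      (x 0)\<^sup>2 + (\<Sum>i<N. (x (Suc i) - x i)\<^sup>2) + c\<^sup>2 * (x N)\<^sup>2"
    unfolding sum_chain by (simp add: inner_diff_left x_def power_mult_distrib)
  ultimately have "(\<Sum>i\<le>Suc N. (inner (chain N c i) v)\<^sup>2) \<le> 4 * (\<Sum>i\<le>N. (x i)\<^sup>2)"
    using chain zero_le_power2[of "x N"] by linarith
  also have "\<dots> \<le> 4 * (norm v)\<^sup>2"
    using sum_coord_le_norm[of "{..N}" v] by (simp add: x_def)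
  finally show ?thesis .
qed

locale chain_function =
  fixes d N :: nat and c \<alpha> \<beta> :: real
  assumes N_less: "N < d" and \<alpha>_nonneg: "0 \<le> \<alpha>" and \<beta>_nonneg: "0 \<le> \<beta>" and c_le: "c\<^sup>2 \<le> 1"
begin

sublocale regularized_least_squares "Rd d" "{..Suc N}" "chain N c" "\<lambda>i. if i = 0 then 1 else 0" \<alpha> \<beta>
proof
  fix i assume "i \<in> {..Suc N}"
  then show "chain N c i \<in> Rd d"
    using N_less by (cases i) (auto intro!: subspace_diff subspace_scale subspace_Rd unit_seq_in_Rd)
qed (simp_all add: subspace_Rd \<alpha>_nonneg \<beta>_nonneg)

lemma chain_smooth: "smooth_on_space (4 * \<alpha> + \<beta>) (Rd d) objective"
  using objective_smooth[OF chain_form_le[OF c_le]] by (simp add: mult.commute)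

text \<open>Row \<open>Suc j\<close> involves no coordinates other than \<open>j\<close> and
  \<open>Suc j\<close>. For \<open>j < m\<close> it lies in \<open>Rd (Suc m)\<close>; for
  \<open>j \<ge> m\<close> its residual at \<open>x\<close> is 0. Row 0 is the first basis vector,
  and its target 1 is what starts the propagation from 0.\<close>

lemma grad_in_Rd_Suc:
  assumes "x \<in> Rd m"
  shows "grad x \<in> Rd (Suc m)"
proof -
  have "(inner (chain N c i) x - (if i = 0 then 1 else 0)) *\<^sub>R chain N c i \<in> Rd (Suc m)"
    if "i \<le> Suc N" for i
  proof (cases i)
    case 0
    then show ?thesis
      by (auto intro!: subspace_scale subspace_Rd unit_seq_in_Rd)
  next
    case (Suc j)
    show ?thesis
    proof (cases "j < m")
      case True
      then have "chain N c i \<in> Rd (Suc m)"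
        using Suc by (auto intro!: subspace_diff subspace_scale subspace_Rd unit_seq_in_Rd)
      then show ?thesis
        by (intro subspace_scale subspace_Rd)
    next
      case False
      then have "inner (chain N c i) x = 0"
        using Suc assms by (auto simp: Rd_def inner_diff_left)
      then show ?thesis
        using Suc by (simp add: subspace_0 subspace_Rd)
    qed
  qed
  moreover have "x \<in> Rd (Suc m)"
    using assms Rd_mono[of m "Suc m"] by auto
  ultimately show ?thesis
    unfolding grad_def
    by (intro subspace_add[OF subspace_Rd subspace_scale[OF subspace_Rd subspace_sum[OF subspace_Rd]]
          subspace_scale[OF subspace_Rd]]) auto
qed

lemma iterate_in_Rd:
  assumes "delayed_linear_span_algorithm \<tau> (Rd d) A"
  shows "A objective k \<in> Rd (k div (\<tau> + 1))"
  by (rule delayed_linear_span_algorithm_iterate[OF assms objective_differentiable])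
    (simp_all add: subspace_Rd monoI Rd_mono gradient_on_objective grad_in_Rd_Suc)

lemma initial_iterate:
  assumes "delayed_linear_span_algorithm \<tau> (Rd d) A"
  shows "A objective 0 = 0"
  using assms objective_differentiable by (simp add: delayed_linear_span_algorithm_def)

end

section \<open>The strongly convex bound\<close>

text \<open>
  The last weight \<open>1 - q\<close> is chosen so that the geometric sequence \<open>q ^ (i + 1)\<close> also satisfies the
  boundary equation of the finite chain.
\<close>

lemma chain_residual_geometric:
  fixes q :: real
  shows "(q - 1) *\<^sub>R unit_seq 0 + (\<Sum>i<N. ((q - 1) * q ^ Suc i) *\<^sub>R (unit_seq (Suc i) - unit_seq i)) +
      ((1 - q) * q ^ Suc N) *\<^sub>R unit_seq N = - (1 - q)\<^sup>2 *\<^sub>R (\<Sum>i<Suc N. q ^ i *\<^sub>R unit_seq i)"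
  (is "?l N = ?r N")
proof (induction N)
  case 0
  have "(q - 1) *\<^sub>R unit_seq 0 + ((1 - q) * q) *\<^sub>R unit_seq 0 = (- (1 - q)\<^sup>2) *\<^sub>R unit_seq 0"
    unfolding scaleR_add_left[symmetric] by (simp add: power2_eq_square algebra_simps)
  then show ?case
    by simp
next
  case (Suc N)
  have "?l (Suc N) = ?l N + (((q - 1) * q ^ Suc N + (1 - q) * q ^ Suc (Suc N)) *\<^sub>R unit_seq (Suc N)
      - ((q - 1) * q ^ Suc N + (1 - q) * q ^ Suc N) *\<^sub>R unit_seq N)"
    by (simp only: sum.lessThan_Suc scaleR_diff_right scaleR_add_left) simp
  also have "((q - 1) * q ^ Suc N + (1 - q) * q ^ Suc (Suc N)) = - (1 - q)\<^sup>2 * q ^ Suc N"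
    by (simp add: power2_eq_square algebra_simps)
  also have "(q - 1) * q ^ Suc N + (1 - q) * q ^ Suc N = 0"
    by (simp add: algebra_simps)
  also have "?l N = ?r N"
    by (rule Suc)
  finally show ?case
    by (simp add: scaleR_add_right)
qed

lemma strongly_convex_lower_bound:
  fixes \<mu> lam :: real
  assumes "0 < lam" "lam < \<mu>" and "\<tau> + 1 \<le> k" and d: "2 * (k div (\<tau> + 1)) \<le> d"
    and A: "delayed_linear_span_algorithm \<tau> (Rd d) A"
  shows "\<exists>F w.
      smooth_on_space \<mu> (Rd d) F \<and> strongly_convex_on lam (Rd d) F \<and>
      is_arg_min F (\<lambda>v. v \<in> Rd d) w \<and> w \<noteq> A F 0 \<and>
      F (A F k) - F w \<ge>
        lam / 4 * exp (- (5 * real k / ((sqrt (\<mu> / lam) - 1) * (real \<tau> + 1)))) *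
        (norm (A F 0 - w))\<^sup>2"
proof -
  define m where "m = k div (\<tau> + 1)"
  have m: "1 \<le> m"
    using \<open>\<tau> + 1 \<le> k\<close> by (simp add: m_def div_greater_zero_iff Suc_le_eq)
  \<comment> \<open>The chain has \<open>2 * m\<close> coordinates: \<open>m\<close> that the
    iterate may reach and \<open>m\<close> that it cannot.\<close>
  define N where "N = 2 * m - 1"
  have N: "Suc N = 2 * m" "N < d"
    using m d[folded m_def] by (auto simp: N_def)
  define s where "s = sqrt (\<mu> / lam)"
  have s: "1 < s" and s2: "s\<^sup>2 = \<mu> / lam"
    using assms(1,2) by (simp_all add: s_def)
  define q where "q = (s - 1) / (s + 1)"
  have q: "0 < q" "q < 1"
    using s by (simp_all add: q_def)
  \<comment> \<open>This makes the smoothness constant \<open>4 * \<alpha> + lam\<close> equal to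
    \<mu>.\<close>
  define \<alpha> where "\<alpha> = (\<mu> - lam) / 4"
  \<comment> \<open>This is the characteristic equation of the stationarity recurrence in the
    interior of the chain; \<open>q\<close> is its root below 1.\<close>
  have \<alpha>q: "\<alpha> * (1 - q)\<^sup>2 = lam * q"
  proof -
    have "1 - q = 2 / (s + 1)"
      using s by (simp add: q_def field_simps)
    moreover have "\<alpha> = lam * (s\<^sup>2 - 1) / 4"
      using assms(1) by (simp add: s2 \<alpha>_def field_simps)
    moreover have "s\<^sup>2 - 1 = (s - 1) * (s + 1)"
      by (simp add: power2_eq_square algebra_simps)
    ultimately show ?thesis
      using s by (simp add: q_def power2_eq_square)
  qed
  \<comment> \<open>The end row enters squared, so \<open>c = sqrt (1 - q)\<close> produces the
    weight \<open>1 - q\<close>.\<close>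
  interpret chain_function d N "sqrt (1 - q)" \<alpha> lam
    by standard (use assms q N in \<open>auto simp: \<alpha>_def\<close>)
  define w where "w = (\<Sum>i<Suc N. q ^ Suc i *\<^sub>R unit_seq i)"
  have coord_w: "coord w i = (if i < Suc N then q ^ Suc i else 0)" for i
    unfolding w_def by (rule coord_sum_unit_seq)
  have w_Rd: "w \<in> Rd d"
    unfolding w_def using N by (intro sum_unit_seq_in_Rd) simp
  have norm_w: "(norm w)\<^sup>2 = (\<Sum>i<2 * m. (q ^ Suc i)\<^sup>2)"
    unfolding w_def norm_sum_unit_seq N(1) by simp
  have crit: "grad w = 0"
  proof -
    have "(\<Sum>i\<le>Suc N. (inner (chain N (sqrt (1 - q)) i) w - (if i = 0 then 1 else 0)) *\<^sub>R
          chain N (sqrt (1 - q)) i) =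
        (q - 1) *\<^sub>R unit_seq 0 + (\<Sum>i<N. ((q - 1) * q ^ Suc i) *\<^sub>R (unit_seq (Suc i) - unit_seq i)) +
        ((1 - q) * q ^ Suc N) *\<^sub>R unit_seq N"
      unfolding sum_chain
    proof (intro arg_cong2[where f = "(+)"] sum.cong refl)
      fix i assume "i \<in> {..<N}"
      then have "inner (chain N (sqrt (1 - q)) (Suc i)) w = (q - 1) * q ^ Suc i"
        by (simp add: inner_diff_left coord_w algebra_simps)
      then show "(inner (chain N (sqrt (1 - q)) (Suc i)) w - (if Suc i = 0 then 1 else 0)) *\<^sub>R
          chain N (sqrt (1 - q)) (Suc i) = ((q - 1) * q ^ Suc i) *\<^sub>R (unit_seq (Suc i) - unit_seq i)"
        using \<open>i \<in> {..<N}\<close> by simp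
    next
      have "sqrt (1 - q) * q ^ Suc N * sqrt (1 - q) = (sqrt (1 - q) * sqrt (1 - q)) * q ^ Suc N"
        by (simp only: ac_simps)
      also have "sqrt (1 - q) * sqrt (1 - q) = 1 - q"
        using q by simp
      finally show "(inner (chain N (sqrt (1 - q)) (Suc N)) w - (if Suc N = 0 then 1 else 0)) *\<^sub>R
          chain N (sqrt (1 - q)) (Suc N) = ((1 - q) * q ^ Suc N) *\<^sub>R unit_seq N"
        by (simp add: coord_w del: power_Suc)
    qed (simp add: coord_w)
    also have "\<dots> = - (1 - q)\<^sup>2 *\<^sub>R (\<Sum>i<Suc N. q ^ i *\<^sub>R unit_seq i)"
      by (rule chain_residual_geometric)
    finally have res: "(\<Sum>i\<le>Suc N. (inner (chain N (sqrt (1 - q)) i) w - (if i = 0 then 1 else 0)) *\<^sub>R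
        chain N (sqrt (1 - q)) i) = - (1 - q)\<^sup>2 *\<^sub>R (\<Sum>i<Suc N. q ^ i *\<^sub>R unit_seq i)" .
    have "w = q *\<^sub>R (\<Sum>i<Suc N. q ^ i *\<^sub>R unit_seq i)"
      unfolding w_def scaleR_sum_right by simp
    then have "grad w = (lam * q - \<alpha> * (1 - q)\<^sup>2) *\<^sub>R (\<Sum>i<Suc N. q ^ i *\<^sub>R unit_seq i)"
      unfolding grad_def res by (simp add: scaleR_diff_left del: sum.lessThan_Suc)
    then show ?thesis
      by (simp add: \<alpha>q)
  qed
  define v where "v = A objective k"
  have v: "v \<in> Rd m"
    unfolding v_def by (rule iterate_in_Rd[OF A, of k, folded m_def])
  \<comment> \<open>The second half of the coordinates of \<open>w\<close> is \<open>q ^ m\<close>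
    times the first half. With \<open>S\<close> the squared norm of the first half, the second
    contributes \<open>q ^ (2 * m) * S\<close>, and the whole is at most \<open>2 * S\<close>. On
    the second half \<open>v\<close> vanishes.\<close>
  have tail: "q ^ (2 * m) * (norm w)\<^sup>2 \<le> 2 * (norm (v - w))\<^sup>2"
  proof -
    define S where "S = (\<Sum>i<m. (q ^ Suc i)\<^sup>2)"
    have sum_add: "(\<Sum>i<m + n. f i) = (\<Sum>i<m. f i) + (\<Sum>i<n. f (m + i))"
      for f :: "nat \<Rightarrow> real" and n
      by (induction n) (simp_all add: add.assoc)
    have shift: "(\<Sum>i<m. (q ^ Suc (m + i))\<^sup>2) = q ^ (2 * m) * S"
      by (simp add: S_def sum_distrib_left power_add power_mult_distrib power_mult[symmetric] mult_ac)
    have S: "0 \<le> S"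
      by (simp add: S_def sum_nonneg)
    have "q ^ (2 * m) \<le> 1"
      using q by (simp add: power_le_one)
    then have "q ^ (2 * m) * S \<le> 1 * S"
      by (rule mult_right_mono[OF _ S])
    moreover have "(norm w)\<^sup>2 = S + (\<Sum>i<m. (q ^ Suc (m + i))\<^sup>2)"
      by (simp only: norm_w mult_2 sum_add S_def)
    ultimately have "(norm w)\<^sup>2 \<le> 2 * S"
      unfolding shift by linarith
    then have "q ^ (2 * m) * (norm w)\<^sup>2 \<le> q ^ (2 * m) * (2 * S)"
      using q by (intro mult_left_mono) auto
    also have "\<dots> = 2 * (\<Sum>i\<in>{m..<2 * m}. (coord (v - w) i)\<^sup>2)"
    proof -
      have "(\<Sum>i\<in>{m..<2 * m}. (coord (v - w) i)\<^sup>2) = (\<Sum>i\<in>{m..<m + m}. (q ^ Suc i)\<^sup>2)"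
        using v N by (intro sum.cong) (auto simp: coord_diff coord_w Rd_def)
      also have "\<dots> = (\<Sum>i<m. (q ^ Suc (m + i))\<^sup>2)"
        using sum.shift_bounds_nat_ivl[of "\<lambda>i. (q ^ Suc i)\<^sup>2" 0 m m]
        by (simp add: lessThan_atLeast0 add.commute)
      finally show ?thesis
        using shift by simp
    qed
    also have "\<dots> \<le> 2 * (norm (v - w))\<^sup>2"
      by (simp add: sum_coord_le_norm)
    finally show ?thesis .
  qed
  \<comment> \<open>From \<open>1 / q = 1 + 2 / (s - 1) \<le> exp (2 / (s - 1))\<close> the exponent
    is at least \<open>- 4 * m / (s - 1)\<close>, and \<open>m \<le> k / (\<tau> + 1)\<close>; the 4
    is then weakened to 5.\<close>
  have rate: "exp (- (5 * real k / ((s - 1) * (real \<tau> + 1)))) \<le> q ^ (2 * m)"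
  proof -
    have "real m \<le> real k / (real \<tau> + 1)"
      using of_nat_div_le_of_nat[of k "\<tau> + 1", where ?'a = real] by (simp add: m_def add.commute)
    then have "4 * real m / (s - 1) \<le> 4 * (real k / (real \<tau> + 1)) / (s - 1)"
      using s by (intro divide_right_mono mult_left_mono) auto
    also have "\<dots> = 4 * real k / ((s - 1) * (real \<tau> + 1))"
      by (simp add: mult.commute)
    also have "\<dots> \<le> 5 * real k / ((s - 1) * (real \<tau> + 1))"
      using s by (intro divide_right_mono) auto
    finally have "exp (- (5 * real k / ((s - 1) * (real \<tau> + 1)))) \<le> exp (- (4 * real m / (s - 1)))"
      by simp
    also have "\<dots> = exp (- (2 / (s - 1))) ^ (2 * m)"
      by (simp add: exp_of_nat_mult[symmetric] mult.commute)
    also have "\<dots> \<le> q ^ (2 * m)"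
    proof (rule power_mono)
      have "inverse q = 1 + 2 / (s - 1)"
        using s by (simp add: q_def field_simps)
      also have "\<dots> \<le> exp (2 / (s - 1))"
        by (rule exp_ge_add_one_self)
      finally show "exp (- (2 / (s - 1))) \<le> q"
        using q by (simp add: exp_minus inverse_le_iff_le[of q, symmetric] del: inverse_le_iff_le)
    qed simp
    finally show ?thesis .
  qed
  have "lam / 4 * exp (- (5 * real k / ((s - 1) * (real \<tau> + 1)))) * (norm w)\<^sup>2 \<le>
      lam / 4 * q ^ (2 * m) * (norm w)\<^sup>2"
    using rate assms(1) by (intro mult_right_mono mult_left_mono) auto
  also have "\<dots> \<le> lam / 4 * (2 * (norm (v - w))\<^sup>2)"
    unfolding mult.assoc using tail assms(1) by (intro mult_left_mono) auto
  also have "\<dots> \<le> objective v - objective w"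
    unfolding objective_diff_critical[OF crit] using \<alpha>_nonneg by (simp add: sum_nonneg)
  finally have "objective v - objective w \<ge>
      lam / 4 * exp (- (5 * real k / ((s - 1) * (real \<tau> + 1)))) * (norm (A objective 0 - w))\<^sup>2"
    by (simp add: initial_iterate[OF A])
  \<comment> \<open>This keeps the right-hand side of the bound from being 0.\<close>
  moreover have "w \<noteq> A objective 0"
  proof -
    have "coord w 0 \<noteq> coord 0 0"
      using q by (simp add: coord_w zero_fin_seq.rep_eq)
    then show ?thesis
      by (auto simp: initial_iterate[OF A])
  qed
  moreover have "4 * \<alpha> + lam = \<mu>"
    by (simp add: \<alpha>_def field_simps)
  ultimately show ?thesis
    using chain_smooth objective_strongly_convex critical_is_arg_min[OF crit w_Rd]
    unfolding v_def s_def by metis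
qed

section \<open>The convex quadratic bound\<close>

lemma convex_quadratic_lower_bound:
  fixes \<mu> :: real
  assumes "0 < \<mu>" and "\<tau> + 1 \<le> k" and d: "k div (\<tau> + 1) < d"
    and A: "delayed_linear_span_algorithm \<tau> (Rd d) A"
  shows "\<exists>F w.
      smooth_on_space \<mu> (Rd d) F \<and> convex_on (Rd d) F \<and> quadratic_on_Rd d F \<and>
      is_arg_min F (\<lambda>v. v \<in> Rd d) w \<and> w \<noteq> A F 0 \<and>
      F (A F k) - F w \<ge> \<mu> * (real \<tau> + 1)\<^sup>2 * (norm (A F 0 - w))\<^sup>2 / (45 * (real k)\<^sup>2)"
proof -
  define m where "m = k div (\<tau> + 1)"
  \<comment> \<open>The chain has \<open>m + 1\<close> coordinates, one more than the iterate can
    reach. With \<open>c = 0\<close> its end is free, so the all-ones vector has zero residuals;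
    \<alpha> = \<open>\<mu> / 4\<close> gives smoothness constant \<mu>.\<close>
  interpret chain_function d m 0 "\<mu> / 4" 0
    by standard (use assms in \<open>auto simp: m_def\<close>)
  define w where "w = (\<Sum>i<Suc m. 1 *\<^sub>R unit_seq i)"
  have coord_w: "coord w i = (if i < Suc m then 1 else 0)" for i
    unfolding w_def by (rule coord_sum_unit_seq)
  have w_Rd: "w \<in> Rd d"
    unfolding w_def using N_less by (intro sum_unit_seq_in_Rd) simp
  have norm_w: "(norm w)\<^sup>2 = real m + 1"
    unfolding w_def norm_sum_unit_seq by simp
  have crit: "grad w = 0"
    unfolding grad_def sum_chain by (simp add: coord_w inner_diff_left)
  define v where "v = A objective k"
  have v: "v \<in> Rd m"
    unfolding v_def by (rule iterate_in_Rd[OF A, of k, folded m_def])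
  define x where "x = coord (v - w)"
  have "x m = -1"
    using v by (simp add: x_def coord_diff coord_w Rd_def)
  have "1 \<le> (real m + 1) * (\<Sum>i\<le>Suc m. (inner (chain m 0 i) (v - w))\<^sup>2)"
  proof -
    \<comment> \<open>\<open>z i\<close> is row \<open>i\<close> applied to \<open>v - w\<close>;
      row \<open>Suc m\<close> contributes 0 because \<open>c = 0\<close>. The \<open>z i\<close>
      telescope to \<open>x m = -1\<close>, and Cauchy-Schwarz against the constant 1 gives the
      bound.\<close>
    define z where "z i = (if i = 0 then x 0 else x i - x (i - 1))" for i
    have "(\<Sum>i\<le>m. z i) = x m"
      by (induction m) (simp_all add: z_def)
    then have "1 = (\<Sum>i\<le>m. z i)\<^sup>2"
      using \<open>x m = -1\<close> by simp
    also have "\<dots> \<le> (\<Sum>i\<le>m. (z i)\<^sup>2) * (\<Sum>i\<le>m. 1\<^sup>2)"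
      using Cauchy_Schwarz_ineq_sum[of z "\<lambda>_. 1" "{..m}"] by simp
    also have "\<dots> = (real m + 1) * (\<Sum>i\<le>m. (z i)\<^sup>2)"
      by simp
    also have "(\<Sum>i\<le>m. (z i)\<^sup>2) = (\<Sum>i\<le>Suc m. (inner (chain m 0 i) (v - w))\<^sup>2)"
      unfolding sum_chain by (simp add: z_def sum.atMost_shift inner_diff_left x_def)
    finally show ?thesis .
  qed
  then have "1 / (real m + 1) \<le> (\<Sum>i\<le>Suc m. (inner (chain m 0 i) (v - w))\<^sup>2)"
    by (simp only: pos_divide_le_eq of_nat_0_le_iff add_nonneg_pos zero_less_one mult.commute)
  then have "\<mu> / 8 * (1 / (real m + 1)) \<le> \<mu> / 8 * (\<Sum>i\<le>Suc m. (inner (chain m 0 i) (v - w))\<^sup>2)"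
    using assms(1) by (intro mult_left_mono) auto
  then have gap: "\<mu> / 8 / (real m + 1) \<le> objective v - objective w"
    unfolding objective_diff_critical[OF crit] by simp
  have k: "0 < real k"
    using assms(2) by simp
  \<comment> \<open>As the squared norm of \<open>w\<close> is \<open>m + 1\<close>, the claim
    reduces to \<open>8 * (m + 1)\<^sup>2 * (\<tau> + 1)\<^sup>2 \<le> 45 * k\<^sup>2\<close>. Since
    \<open>m \<ge> 1\<close>, \<open>(m + 1) * (\<tau> + 1) \<le> 2 * m * (\<tau> + 1) \<le> 2 *
    k\<close>, so the left side is at most \<open>32 * k\<^sup>2\<close>.\<close>
  have "\<mu> * (real \<tau> + 1)\<^sup>2 * (norm w)\<^sup>2 / (45 * (real k)\<^sup>2) \<le> \<mu> / 8 / (real m + 1)"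
  proof -
    have "1 \<le> m"
      using \<open>\<tau> + 1 \<le> k\<close> by (simp add: m_def div_greater_zero_iff Suc_le_eq)
    moreover have "(\<tau> + 1) * m \<le> k"
      unfolding m_def by (rule times_div_less_eq_dividend)
    ultimately have "(real m + 1) * (real \<tau> + 1) \<le> 2 * real k"
    proof -
      have "(m + 1) * (\<tau> + 1) \<le> (2 * m) * (\<tau> + 1)"
        using \<open>1 \<le> m\<close> by (intro mult_right_mono) auto
      also have "\<dots> \<le> 2 * k"
        using \<open>(\<tau> + 1) * m \<le> k\<close> by (simp add: mult_ac)
      finally have "real ((m + 1) * (\<tau> + 1)) \<le> real (2 * k)"
        by (rule of_nat_mono)
      then show ?thesis
        by (simp add: algebra_simps)
    qed
    then have "((real m + 1) * (real \<tau> + 1))\<^sup>2 \<le> (2 * real k)\<^sup>2"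
      by (intro power_mono) auto
    then have "(real m + 1)\<^sup>2 * (real \<tau> + 1)\<^sup>2 \<le> 4 * (real k)\<^sup>2"
      by (simp add: power_mult_distrib)
    then have "8 * ((real m + 1)\<^sup>2 * (real \<tau> + 1)\<^sup>2) \<le> 45 * (real k)\<^sup>2"
      using zero_le_power2[of "real k"] by linarith
    then have "\<mu> * (8 * ((real m + 1)\<^sup>2 * (real \<tau> + 1)\<^sup>2)) \<le> \<mu> * (45 * (real k)\<^sup>2)"
      using assms(1) by (intro mult_left_mono) auto
    then show ?thesis
      unfolding norm_w using k
      by (simp add: divide_le_eq le_divide_eq power2_eq_square mult_ac)
  qed
  then have "objective v - objective w \<ge>
      \<mu> * (real \<tau> + 1)\<^sup>2 * (norm (A objective 0 - w))\<^sup>2 / (45 * (real k)\<^sup>2)"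
    using gap by (simp add: initial_iterate[OF A])
  moreover have "w \<noteq> A objective 0"
  proof -
    have "coord w 0 \<noteq> coord 0 0"
      by (simp add: coord_w zero_fin_seq.rep_eq)
    then show ?thesis
      by (auto simp: initial_iterate[OF A])
  qed
  moreover have "convex_on (Rd d) objective"
    using objective_strongly_convex by (simp add: strongly_convex_on_def)
  moreover have "quadratic_on_Rd d objective"
  proof -
    have "quadratic_on_Rd d
        (\<lambda>w. \<Sum>i\<le>Suc m. \<mu> / 4 / 2 * (inner (chain m 0 i) w - (if i = 0 then 1 else 0))\<^sup>2)"
      by (intro quadratic_on_Rd_sum quadratic_on_Rd_cmult_square a_in_E)
    then show ?thesis
      by (simp add: objective_def[abs_def] sum_distrib_left del: sum.atMost_Suc)
  qed
  moreover have "4 * (\<mu> / 4) + 0 = \<mu>"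
    by simp
  ultimately show ?thesis
    using chain_smooth critical_is_arg_min[OF crit w_Rd] unfolding v_def by metis
qed

section \<open>Both bounds with a common dimension threshold\<close>

theorem theorem3:
  fixes \<tau> k :: nat and \<mu> lam :: real
  assumes "0 < lam" and "lam < \<mu>" and "\<tau> + 1 \<le> k"
  shows "\<exists>D::nat. \<forall>d\<ge>D. \<forall>A. delayed_linear_span_algorithm \<tau> (Rd d) A \<longrightarrow>
    (\<exists>F w.
      smooth_on_space \<mu> (Rd d) F \<and> strongly_convex_on lam (Rd d) F \<and>
      is_arg_min F (\<lambda>v. v \<in> Rd d) w \<and> w \<noteq> A F 0 \<and>
      F (A F k) - F w \<ge>
        lam / 4 * exp (- (5 * real k / ((sqrt (\<mu> / lam) - 1) * (real \<tau> + 1)))) *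
        (norm (A F 0 - w))\<^sup>2) \<and>
    (\<exists>F w.
      smooth_on_space \<mu> (Rd d) F \<and> convex_on (Rd d) F \<and> quadratic_on_Rd d F \<and>
      is_arg_min F (\<lambda>v. v \<in> Rd d) w \<and> w \<noteq> A F 0 \<and>
      F (A F k) - F w \<ge>
        \<mu> * (real \<tau> + 1)\<^sup>2 * (norm (A F 0 - w))\<^sup>2 / (45 * (real k)\<^sup>2))"
proof (intro exI[of _ "2 * (k div (\<tau> + 1))"] allI impI conjI)
  fix d A assume d: "2 * (k div (\<tau> + 1)) \<le> d" and A: "delayed_linear_span_algorithm \<tau> (Rd d) A"
  \<comment> \<open>The quadratic chain needs \<open>m + 1\<close> coordinates for
    \<open>m = k div (\<tau> + 1)\<close>; the threshold \<open>2 * m\<close> of the strongly convex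
    chain supplies them because \<open>m\<close> is positive.\<close>
  have "0 < k div (\<tau> + 1)"
    using assms(3) by (simp add: div_greater_zero_iff)
  then have "k div (\<tau> + 1) < d"
    using d by simp
  then show "\<exists>F w.
      smooth_on_space \<mu> (Rd d) F \<and> convex_on (Rd d) F \<and> quadratic_on_Rd d F \<and>
      is_arg_min F (\<lambda>v. v \<in> Rd d) w \<and> w \<noteq> A F 0 \<and>
      F (A F k) - F w \<ge> \<mu> * (real \<tau> + 1)\<^sup>2 * (norm (A F 0 - w))\<^sup>2 / (45 * (real k)\<^sup>2)"
    by (rule convex_quadratic_lower_bound[rotated 2]) (use assms A in auto)
qed (rule strongly_convex_lower_bound[OF assms])

end
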